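(* Let $\alpha\in\mathbb Z\setminus\{0,1\}$, put $\gamma=\alpha^2-\alpha+1$, and let $(h_n)$ be the sequence with $h_0=0$, $h_1=1$, $h_2=-\alpha^2(\alpha-1)\gamma$, $h_3=-\alpha^6(\alpha-1)^3\gamma^3$, $h_4=\alpha^{12}(\alpha-1)^6\gamma^5$, and for $m\ge2$: $h_{2m+1}=h_{m+2}h_m^3-h_{m-1}h_{m+1}^3$, for $m\ge 3$: $h_{2m}=h_m\big(h_{m+2}h_{m-1}^2-h_{m-2}h_{m+1}^2\big)/h_2$. (i) If $n\equiv 1,3,6,12,15,21,24,26\pmod{27}$, then $h_n$ is a cube. (ii) If $n\equiv 4,23\pmod{27}$, then $h_n$ is a cube if and only if $(\alpha^2-\alpha+1)^2$ is a cube.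
   Context: The sequence defined is the elliptic divisibility sequence attached to the point $(0,0)$ of order $9$ on the Tate normal form curve with $c=\alpha^2(\alpha-1)$, $b=c(\alpha(\alpha-1)+1)$. Convention: an integer $m$ is called a cube if $m=\beta^3$ for some nonzero integer $\beta$. *)

theory Defs
  imports Complex_Main
begin

(* "x is an integer and a cube". Zero is not a cube under this convention.  The ring is left
   open so that the predicate applies both to integers and to the terms of a rational sequence;
   for the latter it includes the claim that the term is an integer. *)
definition is_cube :: "'a::ring_char_0 \<Rightarrow> bool" where
  "is_cube x \<longleftrightarrow> (\<exists>\<beta>::int. \<beta> \<noteq> 0 \<and> x = of_int (\<beta> ^ 3))"

end

theory Submission
  imports Defs
begin

text \<open>
  With \<open>\<beta> = \<alpha> - 1\<close> and \<open>C = \<alpha>\<^sup>7 \<beta>\<^sup>4 \<gamma>\<^sup>3\<close> the sequence is given by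
  \<open>h (9 k + r) = T r * (C\<^sup>2) ^ (k r) * (- C\<^sup>9) ^ k\<^sup>2\<close>, where \<open>T r = h r\<close> is, for \<open>0 < r < 9\<close>, a signed monomial
  in \<open>\<alpha>, \<beta>, \<gamma>\<close> and \<open>T 0 = 0\<close> because the point has order 9. Both recurrences are homogeneous under the
  shift \<open>n \<mapsto> n + 9\<close>, so this closed form need only be checked at nine consecutive indices, where after
  cancelling a common monomial it amounts to one of the relations \<open>\<alpha> \<beta> = \<gamma> - 1\<close>, \<open>\<beta>\<^sup>2 = \<gamma> - \<alpha>\<close>,
  \<open>\<beta> = \<alpha> - 1\<close>. Consequently \<open>h (27 q + s)\<close> differs from \<open>h s\<close> by a nonzero cube, and the exponents of the
  monomial \<open>h s\<close> decide.
\<close>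

section \<open>Monomials and their linear relations\<close>

locale tate9 =
  fixes a b g :: int
  assumes b_eq: "b = a - 1" and g_eq: "g = a\<^sup>2 - a + 1"
begin

definition mon :: "nat \<Rightarrow> nat \<Rightarrow> nat \<Rightarrow> int" where
  "mon i j l = a ^ i * b ^ j * g ^ l"

lemma mon_mult: "mon i j l * mon i' j' l' = mon (i + i') (j + j') (l + l')"
  by (simp add: mon_def power_add ac_simps)

lemma mon_power: "mon i j l ^ n = mon (i * n) (j * n) (l * n)"
  by (simp add: mon_def power_mult_distrib power_mult)

lemma mon_ab: "mon (i + 1) (j + 1) l = mon i j (l + 1) - mon i j l"
proof -
  have "mon (i + 1) (j + 1) l = mon i j l * (a * b)"
    by (simp add: mon_def)
  also have "a * b = g - 1"
    by (simp add: b_eq g_eq power2_eq_square algebra_simps)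
  also have "mon i j l * (g - 1) = mon i j (l + 1) - mon i j l"
    by (simp add: mon_def right_diff_distrib)
  finally show ?thesis .
qed

lemma mon_b2: "mon i (j + 2) l = mon i j (l + 1) - mon (i + 1) j l"
proof -
  have "mon i (j + 2) l = mon i j l * b\<^sup>2"
    by (simp add: mon_def power2_eq_square)
  also have "b\<^sup>2 = g - a"
    by (simp add: b_eq g_eq power2_eq_square algebra_simps)
  also have "mon i j l * (g - a) = mon i j (l + 1) - mon (i + 1) j l"
    by (simp add: mon_def right_diff_distrib)
  finally show ?thesis .
qed

lemma mon_b: "mon i (j + 1) l = mon (i + 1) j l - mon i j l"
proof -
  have "mon i (j + 1) l = mon i j l * b"
    by (simp add: mon_def)
  also have "mon i j l * b = mon i j l * (a - 1)"
    by (simp only: b_eq)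
  also have "\<dots> = mon (i + 1) j l - mon i j l"
    by (simp add: mon_def right_diff_distrib)
  finally show ?thesis .
qed

section \<open>The closed form and its shift law\<close>

definition base :: "nat \<Rightarrow> int" where
  "base r = [0, 1, - mon 2 1 1, - mon 6 3 3, mon 12 6 5, mon 19 10 8,
     - mon 27 15 12, - mon 37 21 16, mon 49 28 21] ! r"

text \<open>In the notation above, \<open>mon 14 8 6 = C\<^sup>2\<close> and \<open>mon 63 36 27 = C\<^sup>9\<close>.\<close>

definition H :: "nat \<Rightarrow> int" where
  "H n = base (n mod 9) * mon 14 8 6 ^ (n div 9 * (n mod 9)) * (- mon 63 36 27) ^ (n div 9)\<^sup>2"

text \<open>The cross term of \<open>(k + j)\<^sup>2\<close> supplies the missing power of
  \<open>mon 14 8 6\<close>, whose ninth power is the square of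
  \<open>- mon 63 36 27\<close>.\<close>

lemma H_shift: "H (9 * k + n) = H n * mon 14 8 6 ^ (k * n) * (- mon 63 36 27) ^ k\<^sup>2"
proof -
  let ?A = "mon 14 8 6" and ?B = "- mon 63 36 27"
  define j r where "j = n div 9" and "r = n mod 9"
  have n: "n = 9 * j + r"
    by (simp add: j_def r_def)
  have "?A ^ 9 = ?B\<^sup>2"
    by (simp add: mon_power)
  then have *: "?A ^ (9 * (k * j)) = ?B ^ (2 * (k * j))"
    by (simp only: power_mult)
  have "H (9 * k + n) = base r * ?A ^ ((k + j) * r) * ?B ^ (k + j)\<^sup>2"
    by (simp add: H_def j_def r_def)
  also have "(k + j)\<^sup>2 = j\<^sup>2 + k\<^sup>2 + 2 * (k * j)"
    by (simp add: power2_eq_square algebra_simps)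
  also have "base r * ?A ^ ((k + j) * r) * ?B ^ (j\<^sup>2 + k\<^sup>2 + 2 * (k * j))
    = base r * ?A ^ (j * r) * ?B ^ j\<^sup>2 * ?A ^ (9 * (k * j) + k * r) * ?B ^ k\<^sup>2"
    unfolding power_add distrib_right * by (simp only: ac_simps)
  also have "9 * (k * j) + k * r = k * n"
    by (simp add: n algebra_simps)
  also have "base r * ?A ^ (j * r) * ?B ^ j\<^sup>2 = H n"
    by (simp add: H_def j_def r_def)
  finally show ?thesis .
qed

lemma H_initial:
  "H 0 = 0" "H 1 = 1" "H 2 = - mon 2 1 1" "H 3 = - mon 6 3 3" "H 4 = mon 12 6 5"
  "H 5 = mon 19 10 8" "H 6 = - mon 27 15 12" "H 7 = - mon 37 21 16" "H 8 = mon 49 28 21"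
  "H 9 = 0" "H 10 = - mon 77 44 33" "H 11 = mon 93 53 40" "H 12 = mon 111 63 48"
  "H 13 = - mon 131 74 56" "H 14 = - mon 152 86 65" "H 15 = mon 174 99 75"
  "H 16 = mon 198 113 85" "H 17 = - mon 224 128 96" "H 18 = 0" "H 19 = mon 280 160 120"
  "H 20 = - mon 310 177 133" "H 21 = - mon 342 195 147" "H 22 = mon 376 214 161"
  "H 23 = mon 411 234 176" "H 24 = - mon 447 255 192" "H 26 = mon 525 300 225"
  by (simp_all add: H_def base_def mon_mult mon_power)

section \<open>Both recurrences for the closed form\<close>

lemma H_odd_base:
  assumes "2 \<le> r" "r \<le> 10"
  shows "H (2 * r + 1) = H (r + 2) * H r ^ 3 - H (r - 1) * H (r + 1) ^ 3"
proof -
  have "r \<in> {2, 3, 4, 5, 6, 7, 8, 9, 10}"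
    using assms by auto
  \<comment> \<open>Up to sign, the cited relations have \<open>H (2 * r + 1)\<close> on the left,
    for r = 2, 3, 5, 6. At r = 4 the two products cancel; from r = 7 on one of them contains
    \<open>H 9 = 0\<close>.\<close>
  then show ?thesis
    by (auto simp: H_initial[simplified] mon_mult mon_power)
      (use mon_ab[of 18 9 8] mon_b2[of 37 19 16] mon_b2[of 93 51 40] mon_ab[of 130 73 56]
        in simp_all)
qed

lemma H_even_base:
  assumes "3 \<le> r" "r \<le> 11"
  shows "H 2 * H (2 * r) = H r * (H (r + 2) * H (r - 1) ^ 2 - H (r - 2) * H (r + 1) ^ 2)"
proof -
  have "r \<in> {3, 4, 5, 6, 7, 8, 9, 10, 11}"
    using assms by auto
  then show ?thesis
    \<comment> \<open>These left sides are \<open>H 2 * H (2 * r)\<close> up to sign, for r = 3, 4,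
      5, 6; for larger r a factor \<open>H 9\<close> occurs.\<close>
    using mon_b[of 29 15 13] mon_b2[of 51 27 22] mon_b2[of 79 43 34] mon_b[of 113 63 49]
    by (auto simp: H_initial[simplified] mon_mult mon_power right_diff_distrib distrib_left
        simp flip: mult.assoc)
qed

text \<open>With \<open>r = s + 1\<close>, the indices in either product sum with multiplicity to
  \<open>4 * r + 2\<close>, twice the index on the left; so the shift gives every term the same
  factor \<open>P ^ (4 * r + 2) * Q ^ 4\<close>.\<close>

lemma H_odd:
  assumes "2 \<le> m"
  shows "H (2 * m + 1) = H (m + 2) * H m ^ 3 - H (m - 1) * H (m + 1) ^ 3"
proof -
  \<comment> \<open>Here \<open>s\<close> belongs to the smallest index \<open>m - 1\<close>, which
    avoids truncated subtraction.\<close>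
  define k s where "k = (m - 2) div 9" and "s = (m - 2) mod 9 + 1"
  have m: "m = 9 * k + (s + 1)" and s: "1 \<le> s" "s \<le> 9"
    using assms by (auto simp: k_def s_def)
  define P Q where "P = mon 14 8 6 ^ k" and "Q = (- mon 63 36 27) ^ k\<^sup>2"
  have 1: "H (9 * k + n) = H n * P ^ n * Q" for n
    by (simp add: H_shift P_def Q_def power_mult)
  have 2: "H (9 * (2 * k) + n) = H n * (P ^ n)\<^sup>2 * Q ^ 4" for n
    by (simp only: H_shift P_def Q_def power_mult_distrib flip: power_mult) (simp add: ac_simps)
  have base: "H (2 * (s + 1) + 1) = H (s + 3) * H (s + 1) ^ 3 - H s * H (s + 2) ^ 3"
    using H_odd_base[of "s + 1"] s by (simp add: eval_nat_numeral)
  have idx: "2 * m + 1 = 9 * (2 * k) + (2 * (s + 1) + 1)" "m + 2 = 9 * k + (s + 3)"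
      "m - 1 = 9 * k + s" "m + 1 = 9 * k + (s + 2)"
    by (simp_all add: m)
  \<comment> \<open>Naming \<open>P ^ s\<close> leaves only numeral exponents, hence a polynomial
    identity.\<close>
  define R where "R = P ^ s"
  have P: "P ^ (2 * (s + 1) + 1) = R\<^sup>2 * P ^ 3" "P ^ (s + 3) = R * P ^ 3" "P ^ (s + 1) = R * P"
      "P ^ (s + 2) = R * P\<^sup>2"
    by (simp_all add: R_def power_add eval_nat_numeral)
  show ?thesis
    unfolding idx unfolding m 1 2 P R_def[symmetric] base by algebra
qed

text \<open>Clearing the denominator keeps the identity integral. The index sums are now
  \<open>4 * r\<close> with \<open>r = s + 2\<close>, and \<open>H 2\<close> stays
  unshifted.\<close>

lemma H_even:
  assumes "3 \<le> m"
  shows "H 2 * H (2 * m) = H m * (H (m + 2) * H (m - 1) ^ 2 - H (m - 2) * H (m + 1) ^ 2)"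
proof -
  define k s where "k = (m - 3) div 9" and "s = (m - 3) mod 9 + 1"
  have m: "m = 9 * k + (s + 2)" and s: "1 \<le> s" "s \<le> 9"
    using assms by (auto simp: k_def s_def)
  define P Q where "P = mon 14 8 6 ^ k" and "Q = (- mon 63 36 27) ^ k\<^sup>2"
  have 1: "H (9 * k + n) = H n * P ^ n * Q" for n
    by (simp add: H_shift P_def Q_def power_mult)
  have 2: "H (9 * (2 * k) + n) = H n * (P ^ n)\<^sup>2 * Q ^ 4" for n
    by (simp only: H_shift P_def Q_def power_mult_distrib flip: power_mult) (simp add: ac_simps)
  have base: "H 2 * H (2 * (s + 2)) = H (s + 2) * (H (s + 4) * H (s + 1) ^ 2 - H s * H (s + 3) ^ 2)"
    using H_even_base[of "s + 2"] s by (simp add: eval_nat_numeral)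
  have idx: "2 * m = 9 * (2 * k) + 2 * (s + 2)" "m + 2 = 9 * k + (s + 4)"
      "m - 1 = 9 * k + (s + 1)" "m - 2 = 9 * k + s" "m + 1 = 9 * k + (s + 3)"
    by (simp_all add: m)
  define R where "R = P ^ s"
  have P: "P ^ (2 * (s + 2)) = R\<^sup>2 * P ^ 4" "P ^ (s + 4) = R * P ^ 4" "P ^ (s + 1) = R * P"
      "P ^ (s + 2) = R * P\<^sup>2" "P ^ (s + 3) = R * P ^ 3"
    by (simp_all add: R_def power_add eval_nat_numeral)
  have "H 2 * H (2 * m) = (H 2 * H (2 * (s + 2))) * (R\<^sup>2 * P ^ 4)\<^sup>2 * Q ^ 4"
    unfolding idx 2 P by simp
  then show ?thesis
    unfolding base unfolding idx unfolding m 1 P R_def[symmetric] by algebra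
qed

section \<open>Identification of \<open>h\<close> and reduction modulo 27\<close>

lemma eq_H:
  fixes h :: "nat \<Rightarrow> rat"
  assumes nz: "H 2 \<noteq> 0"
    and init: "\<And>n. n \<le> 4 \<Longrightarrow> h n = of_int (H n)"
    and odd: "\<And>m. m \<ge> 2 \<Longrightarrow>
           h (2 * m + 1) = h (m + 2) * h m ^ 3 - h (m - 1) * h (m + 1) ^ 3"
    and even: "\<And>m. m \<ge> 3 \<Longrightarrow>
           h (2 * m) = h m * (h (m + 2) * h (m - 1) ^ 2 - h (m - 2) * h (m + 1) ^ 2) / h 2"
  shows "h n = of_int (H n)"
proof (induction n rule: less_induct)
  case (less n)
  consider "n \<le> 4" | m where "m \<ge> 2" "n = 2 * m + 1" | m where "m \<ge> 3" "n = 2 * m"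
    by (cases "n \<le> 4"; cases "even n") (auto elim!: evenE oddE)
  then show ?case
  proof cases
    case 1
    then show ?thesis by (rule init)
  next
    case (2 m)
    have "h n = of_int (H (m + 2) * H m ^ 3 - H (m - 1) * H (m + 1) ^ 3)"
      using 2 less.IH by (simp add: odd[unfolded Suc_eq_plus1[symmetric]])
    with 2 show ?thesis
      by (simp only: H_odd)
  next
    case (3 m)
    have "h n = of_int (H m * (H (m + 2) * H (m - 1) ^ 2 - H (m - 2) * H (m + 1) ^ 2)) / of_int (H 2)"
      using 3 less.IH by (simp add: even)
    also have "\<dots> = of_int (H 2 * H (2 * m)) / of_int (H 2)"
      using 3 by (simp only: H_even)
    finally show ?thesis
      using 3 nz by simp
  qed
qed

text \<open>A shift by \<open>k = 3 * q\<close> makes both exponents in \<open>H_shift\<close>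
  multiples of 3.\<close>

lemma H_mod_27:
  obtains d where "H n = H (n mod 27) * d ^ 3" "a * b * g \<noteq> 0 \<Longrightarrow> d \<noteq> 0"
proof
  define q s where "q = n div 27" and "s = n mod 27"
  let ?d = "mon 14 8 6 ^ (q * s) * (- mon 63 36 27) ^ (3 * q\<^sup>2)"
  have "H n = H (9 * (3 * q) + s)"
    by (simp add: q_def s_def)
  also have "\<dots> = H s * mon 14 8 6 ^ (3 * q * s) * (- mon 63 36 27) ^ (3 * q)\<^sup>2"
    by (rule H_shift)
  also have "\<dots> = H s * ?d ^ 3"
    by (simp add: power_mult_distrib ac_simps flip: power_mult)
  finally show "H n = H (n mod 27) * ?d ^ 3"
    by (simp add: s_def)
  show "?d \<noteq> 0" if "a * b * g \<noteq> 0"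
    using that by (simp add: mon_def)
qed

end

section \<open>Cubes among the terms\<close>

lemma is_cube_of_int: "is_cube (of_int x :: 'a::ring_char_0) \<longleftrightarrow> is_cube x"
  by (simp add: is_cube_def)

lemma is_cube_mult_cube:
  fixes x d :: int
  assumes "d \<noteq> 0"
  shows "is_cube (x * d ^ 3) \<longleftrightarrow> is_cube x"
proof
  assume "is_cube (x * d ^ 3)"
  then obtain c where c: "c \<noteq> 0" "x * d ^ 3 = c ^ 3"
    by (auto simp: is_cube_def)
  then have "d ^ 3 dvd c ^ 3"
    by (metis dvd_triv_right)
  then have "d dvd c"
    by simp
  then obtain e where "c = d * e" ..
  with c assms show "is_cube x"
    by (auto simp: is_cube_def power_mult_distrib)
next
  assume "is_cube x"
  then obtain c where "c \<noteq> 0" "x * d ^ 3 = (c * d) ^ 3"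
    by (auto simp: is_cube_def power_mult_distrib)
  with assms show "is_cube (x * d ^ 3)"
    unfolding is_cube_def by (intro exI[of _ "c * d"]) simp
qed

lemma is_cube_cube: "c \<noteq> 0 \<Longrightarrow> is_cube (c ^ 3 :: int)"
  by (auto simp: is_cube_def)

theorem theorem5p17:
  fixes \<alpha> \<gamma> :: int and h :: "nat \<Rightarrow> rat"
  assumes "\<alpha> \<noteq> 0" and "\<alpha> \<noteq> 1"
    and "\<gamma> = \<alpha> ^ 2 - \<alpha> + 1"
    and "h 0 = 0"
    and "h 1 = 1"
    and "h 2 = of_int (- (\<alpha> ^ 2 * (\<alpha> - 1) * \<gamma>))"
    and "h 3 = of_int (- (\<alpha> ^ 6 * (\<alpha> - 1) ^ 3 * \<gamma> ^ 3))"
    and "h 4 = of_int (\<alpha> ^ 12 * (\<alpha> - 1) ^ 6 * \<gamma> ^ 5)"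
    and "\<And>m. m \<ge> 2 \<Longrightarrow>
           h (2 * m + 1) = h (m + 2) * h m ^ 3 - h (m - 1) * h (m + 1) ^ 3"
    and "\<And>m. m \<ge> 3 \<Longrightarrow>
           h (2 * m) = h m * (h (m + 2) * h (m - 1) ^ 2 - h (m - 2) * h (m + 1) ^ 2) / h 2"
  shows "(\<forall>n. n mod 27 \<in> {1, 3, 6, 12, 15, 21, 24, 26} \<longrightarrow> is_cube (h n)) \<and>
         (\<forall>n. n mod 27 \<in> {4, 23} \<longrightarrow>
            (is_cube (h n) \<longleftrightarrow> is_cube ((\<alpha> ^ 2 - \<alpha> + 1) ^ 2)))"
proof -
  define \<beta> where "\<beta> = \<alpha> - 1"
  interpret tate9 \<alpha> \<beta> \<gamma>
    by unfold_locales (simp_all add: \<beta>_def assms(3))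
  \<comment> \<open>Consecutive nonzero integers have the same sign, so \<open>\<gamma> > 1\<close>
    and no monomial vanishes.\<close>
  have "\<alpha> * \<beta> > 0"
    using assms(1,2) by (auto simp: \<beta>_def zero_less_mult_iff)
  moreover have "\<gamma> = \<alpha> * \<beta> + 1"
    by (simp add: assms(3) \<beta>_def power2_eq_square algebra_simps)
  ultimately have nz: "\<alpha> * \<beta> * \<gamma> \<noteq> 0"
    by auto
  then have mon_nz: "mon i j l \<noteq> 0" for i j l
    by (simp add: mon_def)
  have h: "h n = of_int (H n)" for n
  proof (rule eq_H)
    fix n :: nat
    assume "n \<le> 4"
    then have "n \<in> {0, 1, 2, 3, 4}"
      by auto
    with assms(4-8) show "h n = of_int (H n)"
      by (auto simp: H_initial[simplified] mon_def) (simp_all add: \<beta>_def)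
  qed (use assms(9,10) mon_nz H_initial(3) in simp_all)
  have reduce: "is_cube (h n) \<longleftrightarrow> is_cube (H (n mod 27))" for n
    using H_mod_27[of n] nz by (metis h is_cube_of_int is_cube_mult_cube)
  \<comment> \<open>The roots carry a third of the exponents in \<open>H_initial\<close>; signs are
    harmless since -1 is a cube.\<close>
  have cubes: "H 1 = 1 ^ 3" "H 3 = (- mon 2 1 1) ^ 3" "H 6 = (- mon 9 5 4) ^ 3"
    "H 12 = mon 37 21 16 ^ 3" "H 15 = mon 58 33 25 ^ 3" "H 21 = (- mon 114 65 49) ^ 3"
    "H 24 = (- mon 149 85 64) ^ 3" "H 26 = mon 175 100 75 ^ 3"
    by (simp_all add: H_initial[simplified] mon_power)
  have "is_cube (H s)" if "s \<in> {1, 3, 6, 12, 15, 21, 24, 26}" for s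
    using that mon_nz
    by (auto simp only: cubes insert_iff empty_iff neg_equal_0_iff_equal intro!: is_cube_cube)
  \<comment> \<open>Only the exponents of \<open>\<gamma>\<close>, 5 = 2 + 3 * 1 and 176 = 2 + 3 *
    58, are not multiples of 3.\<close>
  moreover have "H 4 = \<gamma>\<^sup>2 * mon 4 2 1 ^ 3" "H 23 = \<gamma>\<^sup>2 * mon 137 78 58 ^ 3"
    by (simp_all add: H_initial mon_def power_mult_distrib flip: power_mult power_add)
  then have "is_cube (H s) \<longleftrightarrow> is_cube (\<gamma>\<^sup>2)" if "s \<in> {4, 23}" for s
    using that mon_nz is_cube_mult_cube by auto
  ultimately show ?thesis
    unfolding reduce assms(3) by blast
qed

end
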